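(* Let $\mathbf{N}$ be the pseudovariety of all finite nilpotent groups. Every cyclic subgroup of a free group is $\mathbf{N}$-closed.
   Context: For a pseudovariety $\mathbf{V}$ of finite groups (a class of finite groups closed under subgroups, homomorphic images and finitary direct products), the pro-$\mathbf{V}$ topology on a group $G$ is the coarsest topology making all homomorphisms from $G$ into (discrete) members of $\mathbf{V}$ continuous; equivalently, $G$ is a topological group in which the normal subgroups $K$ with $G/K \in \mathbf{V}$ form a basis of neighbourhoods of the identity. "$\mathbf{V}$-closed" means closed in the pro-$\mathbf{V}$ topology. The free group may have arbitrary rank. *)

theory Defs
  imports "HOL-Algebra.Elementary_Groups" "HOL-Analysis.Function_Topology"
begin

section \<open>Free groups\<close>

text \<open>The letter \<open>(x, True)\<close> stands for the generator \<open>x\<close> and \<open>(x, False)\<close> for its formal inverse.\<close>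

type_synonym 'b letter = "'b \<times> bool"

definition inv_letter :: "'b letter \<Rightarrow> 'b letter" where
  "inv_letter a = (fst a, \<not> snd a)"

definition reduced :: "'b letter list \<Rightarrow> bool" where
  "reduced w \<longleftrightarrow> successively (\<lambda>a b. b \<noteq> inv_letter a) w"

fun cancel_Cons :: "'b letter \<Rightarrow> 'b letter list \<Rightarrow> 'b letter list" where
  "cancel_Cons a [] = [a]"
| "cancel_Cons a (b # w) = (if b = inv_letter a then w else a # b # w)"

text \<open>The free group on an arbitrary set \<open>X\<close>: reduced words over \<open>X\<close>, multiplied by
  concatenation followed by free reduction.\<close>

definition free_group :: "'b set \<Rightarrow> 'b letter list monoid" where
  "free_group X =
     \<lparr>carrier = {w. reduced w \<and> fst ` set w \<subseteq> X},
      monoid.mult = (\<lambda>u v. foldr cancel_Cons u v),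
      one = []\<rparr>"

lemma inv_letter_inv_letter [simp]: "inv_letter (inv_letter a) = a"
  by (simp add: inv_letter_def)

lemma reduced_cancel_Cons: "reduced w \<Longrightarrow> reduced (cancel_Cons a w)"
  by (cases w) (auto simp: reduced_def successively_Cons)

lemma cancel_Cons_inverse:
  "reduced w \<Longrightarrow> cancel_Cons a (cancel_Cons (inv_letter a) w) = w"
  by (cases w rule: remdups_adj.cases) (auto simp: reduced_def)

lemma reduced_foldr: "reduced w \<Longrightarrow> reduced (foldr cancel_Cons u w)"
  by (induction u) (auto intro: reduced_cancel_Cons)

lemma foldr_cancel_Cons:
  assumes "reduced w"
  shows "foldr cancel_Cons (cancel_Cons a u) w = cancel_Cons a (foldr cancel_Cons u w)"
  using cancel_Cons_inverse[OF reduced_foldr[OF assms]] by (cases u) auto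

lemma foldr_cancel_Cons_assoc:
  "reduced w \<Longrightarrow>
     foldr cancel_Cons (foldr cancel_Cons u v) w = foldr cancel_Cons u (foldr cancel_Cons v w)"
  by (induction u) (auto simp: foldr_cancel_Cons)

lemma letters_cancel_Cons: "set (cancel_Cons a w) \<subseteq> insert a (set w)"
  by (cases w) auto

lemma letters_foldr: "set (foldr cancel_Cons u v) \<subseteq> set u \<union> set v"
proof (induction u)
  case (Cons a u)
  then show ?case
    using letters_cancel_Cons[of a "foldr cancel_Cons u v"] by auto
qed simp

lemma foldr_cancel_Cons_Nil: "reduced w \<Longrightarrow> foldr cancel_Cons w [] = w"
proof (induction w)
  case (Cons a w)
  then show ?case
    by (cases w) (auto simp: reduced_def)
qed simp

lemma foldr_cancel_Cons_inverse:
  "reduced v \<Longrightarrow>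
     foldr cancel_Cons (rev (map inv_letter w)) (foldr cancel_Cons w v) = v"
proof (induction w arbitrary: v)
  case (Cons a w)
  then show ?case
    using cancel_Cons_inverse[OF reduced_foldr[OF Cons.prems], of "inv_letter a" w] by simp
qed simp

lemma reduced_inverse: "reduced w \<Longrightarrow> reduced (rev (map inv_letter w))"
  unfolding reduced_def successively_rev successively_map
  by (erule successively_mono) (metis inv_letter_inv_letter)

lemma group_free_group: "group (free_group X)"
proof (rule groupI)
  fix u v assume "u \<in> carrier (free_group X)" "v \<in> carrier (free_group X)"
  then show "u \<otimes>\<^bsub>free_group X\<^esub> v \<in> carrier (free_group X)"
    using image_mono[OF letters_foldr[of u v], of fst]
    unfolding free_group_def image_Un by (simp add: reduced_foldr) (meson Un_least order_trans)
next
  show "\<one>\<^bsub>free_group X\<^esub> \<in> carrier (free_group X)"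
    by (simp add: free_group_def reduced_def)
next
  fix u v w
  assume "w \<in> carrier (free_group X)"
  then show "u \<otimes>\<^bsub>free_group X\<^esub> v \<otimes>\<^bsub>free_group X\<^esub> w = u \<otimes>\<^bsub>free_group X\<^esub> (v \<otimes>\<^bsub>free_group X\<^esub> w)"
    by (simp add: free_group_def foldr_cancel_Cons_assoc)
next
  fix w show "\<one>\<^bsub>free_group X\<^esub> \<otimes>\<^bsub>free_group X\<^esub> w = w"
    by (simp add: free_group_def)
next
  fix w assume w: "w \<in> carrier (free_group X)"
  then have "foldr cancel_Cons (rev (map inv_letter w)) w = []"
    using foldr_cancel_Cons_inverse[of "[]" w] foldr_cancel_Cons_Nil[of w]
    by (simp add: free_group_def reduced_def)
  moreover have "rev (map inv_letter w) \<in> carrier (free_group X)"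
    using w by (auto simp: free_group_def reduced_inverse inv_letter_def)
  ultimately show "\<exists>v\<in>carrier (free_group X). v \<otimes>\<^bsub>free_group X\<^esub> w = \<one>\<^bsub>free_group X\<^esub>"
    by (intro bexI[of _ "rev (map inv_letter w)"]) (simp_all add: free_group_def)
qed

section \<open>Nilpotent groups\<close>

fun lower_central :: "('a, 'm) monoid_scheme \<Rightarrow> nat \<Rightarrow> 'a set" where
  "lower_central G 0 = carrier G"
| "lower_central G (Suc n) = generate G
     (\<Union>x \<in> lower_central G n. \<Union>y \<in> carrier G.
        {x \<otimes>\<^bsub>G\<^esub> y \<otimes>\<^bsub>G\<^esub> inv\<^bsub>G\<^esub> x \<otimes>\<^bsub>G\<^esub> inv\<^bsub>G\<^esub> y})"

definition nilpotent_group :: "('a, 'm) monoid_scheme \<Rightarrow> bool" where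
  "nilpotent_group G \<longleftrightarrow> group G \<and> (\<exists>n. lower_central G n = {\<one>\<^bsub>G\<^esub>})"

section \<open>The pro-\<open>V\<close> topology\<close>

text \<open>A pseudovariety is closed under isomorphism and every finite group is isomorphic to one
  whose carrier is a set of natural numbers, so it is determined by, and here represented as,
  the set of its members with carrier in \<^typ>\<open>nat\<close>.\<close>

definition finite_nilpotent_groups :: "nat monoid set" where
  "finite_nilpotent_groups = {H. finite (carrier H) \<and> nilpotent_group H}"

text \<open>The coarsest topology on \<open>carrier G\<close> making every homomorphism from \<open>G\<close> into a
  (discrete) member of \<open>V\<close> continuous. The underlying set is all of \<open>carrier G\<close> as soon as
  \<open>V\<close> is nonempty, because of the trivial homomorphisms.\<close>

definition pro_topology :: "nat monoid set \<Rightarrow> ('a, 'm) monoid_scheme \<Rightarrow> 'a topology" where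
  "pro_topology V G = topology_generated_by
     {{x \<in> carrier G. f x \<in> S} | f H S. H \<in> V \<and> f \<in> hom G H \<and> S \<subseteq> carrier H}"

lemma topspace_pro_topology:
  assumes "H \<in> V" "group H"
  shows "topspace (pro_topology V G) = carrier G"
proof -
  interpret H: group H by fact
  have "(\<lambda>_. \<one>\<^bsub>H\<^esub>) \<in> hom G H"
    by (simp add: hom_def)
  then have "carrier G \<in> {{x \<in> carrier G. f x \<in> S} | f H S. H \<in> V \<and> f \<in> hom G H \<and> S \<subseteq> carrier H}"
    using assms by (intro CollectI exI[of _ "\<lambda>_. \<one>\<^bsub>H\<^esub>"] exI[of _ H] exI[of _ "carrier H"]) auto
  then show ?thesis
    unfolding pro_topology_def topology_generated_by_topspace by blast
qed

end

theory Submission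
  imports Defs "HOL-Algebra.Bij" "HOL-Algebra.Product_Groups"
begin

text \<open>A reduced word \<open>z \<noteq> 1\<close> acts nontrivially on integer vectors when its generators are sent to
  unitriangular matrices adapted to its syllables. In the last changed coordinate of a basis vector
  the powers \<open>z\<^sup>n\<close> act by translation by \<open>n\<alpha>\<close> with \<open>\<alpha> \<noteq> 0\<close>, so reducing modulo a suitable multiple of
  \<open>\<alpha>\<close> separates \<open>z\<^sup>k\<close> from the powers of \<open>z\<^sup>m\<close> in a finite nilpotent group whenever \<open>m\<close> does not divide \<open>k\<close>.
  An element \<open>u\<close> commuting with \<open>c\<close> is \<open>z\<^sup>k\<close> with \<open>c = z\<^sup>m\<close>; otherwise a quotient in
  which the commutator of \<open>u\<close> and \<open>c\<close> survives separates \<open>u\<close> from the cyclic group \<open>\<langle>c\<rangle>\<close>.\<close>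

section \<open>Stability groups\<close>

text \<open>In the model case \<open>V j\<close> consists of the vectors supported in the
  coordinates below \<open>j\<close>, and \<open>n\<close> is the number of coordinates.\<close>

locale group_chain = comm_group G for G (structure) +
  fixes V :: "nat \<Rightarrow> 'a set" and n :: nat
  assumes subgroup_chain: "subgroup (V j) G"
    and chain_Suc: "V j \<subseteq> V (Suc j)"
    and chain_0: "V 0 = {\<one>}"
    and chain_top: "V n = carrier G"
begin

text \<open>Additively, \<open>T - 1\<close> goes down \<open>k\<close> steps of the chain.
  Truncated subtraction is right here because \<open>V 0\<close> is trivial: for
  \<open>j \<le> k\<close> the condition says that \<open>T\<close> fixes \<open>V j\<close>
  pointwise. \<open>stab 1\<close> is the stability group of the chain.\<close>

definition stab :: "nat \<Rightarrow> ('a \<Rightarrow> 'a) set" where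
  "stab k = {T \<in> auto G. \<forall>j. \<forall>v \<in> V j. T v \<otimes> inv v \<in> V (j - k)}"

lemma chain_mono: "i \<le> j \<Longrightarrow> V i \<subseteq> V j"
  by (rule lift_Suc_mono_le[of V, OF chain_Suc])

lemma chain_carrier: "v \<in> V j \<Longrightarrow> v \<in> carrier G"
  using subgroup.mem_carrier[OF subgroup_chain] .

lemma chain_mult: "u \<in> V j \<Longrightarrow> v \<in> V j \<Longrightarrow> u \<otimes> v \<in> V j"
  using subgroup.m_closed[OF subgroup_chain] .

lemma chain_inv: "v \<in> V j \<Longrightarrow> inv v \<in> V j"
  using subgroup.m_inv_closed[OF subgroup_chain] .

lemma auto_closed: "T \<in> auto G \<Longrightarrow> v \<in> carrier G \<Longrightarrow> T v \<in> carrier G"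
  by (auto simp: auto_def hom_def)

lemma auto_mult: "T \<in> auto G \<Longrightarrow> u \<in> carrier G \<Longrightarrow> v \<in> carrier G \<Longrightarrow> T (u \<otimes> v) = T u \<otimes> T v"
  by (auto simp: auto_def hom_def)

lemma auto_Bij: "T \<in> auto G \<Longrightarrow> T \<in> Bij (carrier G)"
  by (simp add: auto_def)

lemma auto_carrier_BijGroup: "T \<in> auto G \<Longrightarrow> T \<in> carrier (BijGroup (carrier G))"
  by (simp add: auto_def BijGroup_def)

lemma BijGroup_mult_apply:
  "T \<in> auto G \<Longrightarrow> S \<in> auto G \<Longrightarrow> v \<in> carrier G \<Longrightarrow> (T \<otimes>\<^bsub>BijGroup (carrier G)\<^esub> S) v = T (S v)"
  by (simp add: auto_Bij BijGroup_def compose_def)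

lemma BijGroup_inv_auto: "T \<in> auto G \<Longrightarrow> inv\<^bsub>BijGroup (carrier G)\<^esub> T \<in> auto G"
  using subgroup.m_inv_closed[OF subgroup_auto] .

lemma BijGroup_inv_apply:
  assumes "T \<in> auto G" "v \<in> carrier G"
  shows "T ((inv\<^bsub>BijGroup (carrier G)\<^esub> T) v) = v"
  using assms auto_Bij[OF assms(1)] bij_betw_inv_into_right[of T "carrier G" "carrier G" v]
  by (simp add: inv_BijGroup Bij_def)

lemma stab_auto: "T \<in> stab k \<Longrightarrow> T \<in> auto G"
  by (simp add: stab_def)

lemma stab_diff: "T \<in> stab k \<Longrightarrow> v \<in> V j \<Longrightarrow> T v \<otimes> inv v \<in> V (j - k)"
  by (simp add: stab_def)

lemma stab_chain:
  assumes "T \<in> stab k" "v \<in> V j"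
  shows "T v \<in> V j"
proof -
  have "T v \<otimes> inv v \<in> V j"
    using stab_diff[OF assms] chain_mono[of "j - k" j] by auto
  then have "T v \<otimes> inv v \<otimes> v \<in> V j"
    using assms(2) by (rule chain_mult)
  then show ?thesis
    using assms chain_carrier auto_closed[OF stab_auto] by (simp add: m_assoc)
qed

lemma stab_antimono:
  assumes "k \<le> l"
  shows "stab l \<subseteq> stab k"
proof -
  have "V (j - l) \<subseteq> V (j - k)" for j
    using assms by (intro chain_mono diff_le_mono2)
  then show ?thesis
    unfolding stab_def by blast
qed

text \<open>That \<open>T\<close> is bijective on the whole group and preserves \<open>V j\<close>
  does not by itself make it onto \<open>V j\<close>. Writing \<open>T v = d v\<close> with
  \<open>d\<close> one level lower gives \<open>T^-1 v = (T^-1 d)^-1 v\<close>, and induction covers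
  \<open>T^-1 d\<close>. The index \<open>Suc k\<close> is what makes \<open>d\<close>
  lower.\<close>

lemma stab_inv_chain:
  assumes "T \<in> stab (Suc k)"
  shows "v \<in> V j \<Longrightarrow> (inv\<^bsub>BijGroup (carrier G)\<^esub> T) v \<in> V j"
proof (induction j arbitrary: v)
  case 0
  then have "v = \<one>"
    by (simp add: chain_0)
  moreover have "inv\<^bsub>BijGroup (carrier G)\<^esub> T \<in> hom G G"
    using BijGroup_inv_auto[OF stab_auto[OF assms]] by (simp add: auto_def)
  ultimately show ?case
    using hom_one[of "inv\<^bsub>BijGroup (carrier G)\<^esub> T" G G] by (simp add: chain_0 is_group)
next
  case (Suc j)
  define d where "d = T v \<otimes> inv v"
  let ?I = "inv\<^bsub>BijGroup (carrier G)\<^esub> T"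
  have T: "T \<in> auto G" and I: "?I \<in> auto G" and v: "v \<in> carrier G"
    using stab_auto[OF assms] BijGroup_inv_auto Suc.prems chain_carrier by auto
  have dj: "d \<in> V j"
    using stab_diff[OF assms Suc.prems] chain_mono[of "Suc j - Suc k" j] by (auto simp: d_def)
  then have d: "d \<in> carrier G"
    by (rule chain_carrier)
  have "?I d \<in> V (Suc j)"
    using Suc.IH[OF dj] chain_Suc by auto
  have "T v = d \<otimes> v"
    using T v by (simp add: d_def m_assoc auto_closed)
  moreover have "?I (T v) = v"
    using T v auto_Bij[OF T] by (simp add: inv_BijGroup auto_closed Bij_def bij_betw_def)
  ultimately have "v = ?I d \<otimes> ?I v"
    using auto_mult[OF I d v] by simp
  then have "?I v = inv (?I d) \<otimes> v"
    using I d v by (intro inv_solve_left[THEN iffD2]) (auto simp: auto_closed)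
  then show ?case
    using \<open>?I d \<in> V (Suc j)\<close> Suc.prems by (simp add: chain_mult chain_inv)
qed

text \<open>Additively, \<open>T^-1 v - v = -(T u - u)\<close> for \<open>u = T^-1 v\<close>, and
  \<open>T S v - v = (T - 1)(S v) + (S v - v)\<close>; \<open>stab_inv_chain\<close> and
  \<open>stab_chain\<close> keep \<open>u\<close> and \<open>S v\<close> in
  \<open>V j\<close>.\<close>

lemma subgroup_stab: "subgroup (stab (Suc k)) (BijGroup (carrier G))"
proof (rule group.subgroupI[OF group_BijGroup])
  show "stab (Suc k) \<subseteq> carrier (BijGroup (carrier G))"
    using stab_auto auto_carrier_BijGroup by blast
  have "(\<lambda>x\<in>carrier G. x) \<in> stab (Suc k)"
    using id_in_auto subgroup.one_closed[OF subgroup_chain]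
    by (auto simp: stab_def chain_carrier)
  then show "stab (Suc k) \<noteq> {}"
    by blast
next
  fix T assume T: "T \<in> stab (Suc k)"
  let ?I = "inv\<^bsub>BijGroup (carrier G)\<^esub> T"
  have I: "?I \<in> auto G"
    using stab_auto[OF T] by (rule BijGroup_inv_auto)
  have "?I v \<otimes> inv v \<in> V (j - Suc k)" if v: "v \<in> V j" for v j
  proof -
    have u: "?I v \<in> V j"
      using stab_inv_chain[OF T v] .
    then have "T (?I v) \<otimes> inv (?I v) \<in> V (j - Suc k)"
      by (rule stab_diff[OF T])
    then have "inv (v \<otimes> inv (?I v)) \<in> V (j - Suc k)"
      using BijGroup_inv_apply[OF stab_auto[OF T] chain_carrier[OF v]] by (simp add: chain_inv)
    then show ?thesis
      using u v by (simp add: chain_carrier inv_mult_group)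
  qed
  then show "?I \<in> stab (Suc k)"
    using I by (simp add: stab_def)
next
  fix T S assume T: "T \<in> stab (Suc k)" and S: "S \<in> stab (Suc k)"
  let ?P = "T \<otimes>\<^bsub>BijGroup (carrier G)\<^esub> S"
  have "?P v \<otimes> inv v \<in> V (j - Suc k)" if v: "v \<in> V j" for v j
  proof -
    have Sv: "S v \<in> V j"
      using stab_chain[OF S v] .
    have "(T (S v) \<otimes> inv (S v)) \<otimes> (S v \<otimes> inv v) \<in> V (j - Suc k)"
      using stab_diff[OF T Sv] stab_diff[OF S v] by (rule chain_mult)
    moreover have "v \<in> carrier G" "S v \<in> carrier G" "T (S v) \<in> carrier G"
      using v Sv stab_chain[OF T Sv] chain_carrier by auto
    moreover from this have "inv (S v) \<otimes> (S v \<otimes> inv v) = inv v"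
      by (simp add: m_assoc[symmetric])
    ultimately show ?thesis
      using T S by (simp add: BijGroup_mult_apply stab_auto m_assoc)
  qed
  then show "?P \<in> stab (Suc k)"
    using subgroup.m_closed[OF subgroup_auto stab_auto[OF T] stab_auto[OF S]]
    by (simp add: stab_def)
qed

text \<open>With \<open>T = 1 + a\<close> and \<open>S = 1 + b\<close>, the commutator moves \<open>v = STu\<close> by \<open>TSu - STu = abu - bau\<close>.\<close>

lemma stab_commutator:
  assumes T: "T \<in> stab (Suc k)" and S: "S \<in> stab 1"
  defines "B \<equiv> BijGroup (carrier G)"
  shows "T \<otimes>\<^bsub>B\<^esub> S \<otimes>\<^bsub>B\<^esub> inv\<^bsub>B\<^esub> T \<otimes>\<^bsub>B\<^esub> inv\<^bsub>B\<^esub> S \<in> stab (Suc (Suc k))" (is "?C \<in> _")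
proof -
  interpret B: group B
    unfolding B_def by (rule group_BijGroup)
  have aT: "T \<in> auto G" and aS: "S \<in> auto G"
    using T S stab_auto by auto
  have aI: "inv\<^bsub>B\<^esub> T \<in> auto G" "inv\<^bsub>B\<^esub> S \<in> auto G"
    using aT aS BijGroup_inv_auto by (auto simp: B_def)
  have closed: "P \<otimes>\<^bsub>B\<^esub> Q \<in> auto G" if "P \<in> auto G" "Q \<in> auto G" for P Q
    using subgroup.m_closed[OF subgroup_auto] that by (simp add: B_def)
  have "?C v \<otimes> inv v \<in> V (j - Suc (Suc k))" if v: "v \<in> V j" for v j
  proof -
    define u where "u = (inv\<^bsub>B\<^esub> T) ((inv\<^bsub>B\<^esub> S) v)"
    have Sv: "(inv\<^bsub>B\<^esub> S) v \<in> V j"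
      using stab_inv_chain[of S 0] S v by (simp add: B_def)
    then have u: "u \<in> V j"
      using stab_inv_chain[OF T] by (simp add: B_def u_def)
    have vu: "S (T u) = v"
      using BijGroup_inv_apply[OF aS chain_carrier[OF v]] BijGroup_inv_apply[OF aT chain_carrier[OF Sv]]
      by (simp add: B_def u_def)
    have Cv: "?C v = T (S u)"
      using aT aS aI closed chain_carrier[OF v] chain_carrier[OF Sv] chain_carrier[OF u]
      by (simp add: BijGroup_mult_apply B_def u_def)
    define a where "a = T u \<otimes> inv u"
    define b where "b = S u \<otimes> inv u"
    \<comment> \<open>These are the second-order terms: each passes through both
      \<open>T - 1\<close> and \<open>S - 1\<close> and so drops \<open>k + 2\<close> levels. The
      remaining part \<open>x\<close> is common to \<open>T S u\<close> and \<open>S T u\<close> and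
      cancels.\<close>
    define a' where "a' = T b \<otimes> inv b"
    define b' where "b' = S a \<otimes> inv a"
    have a: "a \<in> V (j - Suc k)"
      unfolding a_def using stab_diff[OF T u] .
    have b: "b \<in> V (j - 1)"
      unfolding b_def using stab_diff[OF S u] .
    have a': "a' \<in> V (j - Suc (Suc k))" and b': "b' \<in> V (j - Suc (Suc k))"
      using stab_diff[OF T b] stab_diff[OF S a] by (simp_all add: a'_def b'_def)
    note car = u[THEN chain_carrier] a[THEN chain_carrier] b[THEN chain_carrier]
      a'[THEN chain_carrier] b'[THEN chain_carrier]
    have eqs: "T u = a \<otimes> u" "S u = b \<otimes> u" "T b = a' \<otimes> b" "S a = b' \<otimes> a"
      using car aT aS by (simp_all add: a_def b_def a'_def b'_def auto_closed m_assoc)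
    define x where "x = a \<otimes> b \<otimes> u"
    have x: "x \<in> carrier G"
      using car by (simp add: x_def)
    have "T (S u) = a' \<otimes> x"
      using car by (simp add: eqs auto_mult[OF aT] x_def m_ac)
    moreover have "v = b' \<otimes> x"
      unfolding vu[symmetric] using car by (simp add: eqs auto_mult[OF aS] x_def m_ac)
    moreover have "x \<otimes> (inv x \<otimes> inv b') = inv b'"
      using x car by (simp add: m_assoc[symmetric])
    ultimately have "T (S u) \<otimes> inv v = a' \<otimes> inv b'"
      using x car by (simp add: m_assoc inv_mult_group)
    then have "?C v \<otimes> inv v = a' \<otimes> inv b'"
      using car by (simp add: Cv)
    then show ?thesis
      using a' b' by (simp add: chain_mult chain_inv)
  qed
  then show ?thesis
    using closed aT aS aI by (simp add: stab_def)
qed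

definition stability_group :: "('a \<Rightarrow> 'a) monoid" where
  "stability_group = (BijGroup (carrier G))\<lparr>carrier := stab 1\<rparr>"

lemma group_stability_group: "group stability_group"
  unfolding stability_group_def
  using subgroup.subgroup_is_group[OF subgroup_stab[of 0] group_BijGroup] by simp

text \<open>Each commutator with an element of \<open>stab 1\<close> gains one level by
  \<open>stab_commutator\<close>. The index is off by one because the series starts at 0 with the
  whole group \<open>stab 1\<close>.\<close>

lemma lower_central_stability_group: "lower_central stability_group k \<subseteq> stab (Suc k)"
proof (induction k)
  case 0
  then show ?case
    by (simp add: stability_group_def)
next
  case (Suc k)
  interpret B: group "BijGroup (carrier G)"
    by (rule group_BijGroup)
  have sub: "subgroup (stab 1) (BijGroup (carrier G))"
    using subgroup_stab[of 0] by simp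
  \<comment> \<open>The lower central series takes inverses in the restricted group,
    \<open>stab_commutator\<close> in the ambient one.\<close>
  have inv_eq: "inv\<^bsub>stability_group\<^esub> T = inv\<^bsub>BijGroup (carrier G)\<^esub> T" if "T \<in> stab 1" for T
    using B.m_inv_consistent[OF sub that] by (simp add: stability_group_def)
  interpret S: group stability_group
    by (rule group_stability_group)
  have "subgroup (stab (Suc (Suc k))) stability_group"
    unfolding stability_group_def
    using B.subgroup_incl[OF subgroup_stab[of "Suc k"] sub] stab_antimono[of 1 "Suc (Suc k)"] by simp
  then show ?case
    unfolding lower_central.simps
  proof (rule S.generate_subgroup_incl[rotated], safe)
    fix T S assume "T \<in> lower_central stability_group k" and S: "S \<in> carrier stability_group"
    then have T: "T \<in> stab (Suc k)" "T \<in> stab 1" and S: "S \<in> stab 1"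
      using Suc.IH stab_antimono[of 1 "Suc k"] by (auto simp: stability_group_def)
    show "T \<otimes>\<^bsub>stability_group\<^esub> S \<otimes>\<^bsub>stability_group\<^esub> inv\<^bsub>stability_group\<^esub> T
        \<otimes>\<^bsub>stability_group\<^esub> inv\<^bsub>stability_group\<^esub> S \<in> stab (Suc (Suc k))"
      using stab_commutator[OF T(1) S] inv_eq[OF T(2)] inv_eq[OF S] by (simp add: stability_group_def)
  qed
qed

text \<open>A drop by at least \<open>n\<close> levels sends \<open>V n\<close>, the whole group,
  into \<open>V 0\<close>. So \<open>T\<close> is pointwise the identity, and extensionality of
  \<open>Bij\<close> turns this into an equality of functions.\<close>

lemma stab_top: "stab (n + k) \<subseteq> {\<one>\<^bsub>stability_group\<^esub>}"
proof
  fix T assume T: "T \<in> stab (n + k)"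
  have "T v = v" if "v \<in> carrier G" for v
    using stab_diff[OF T, of v n] that auto_closed[OF stab_auto[OF T] that]
    by (simp add: chain_top chain_0) (metis inv_closed inv_equality inv_inv)
  moreover have "T \<in> extensional (carrier G)"
    using auto_Bij[OF stab_auto[OF T]] by (rule Bij_imp_extensional)
  ultimately have "T = (\<lambda>x\<in>carrier G. x)"
    by (auto intro: extensionalityI)
  then show "T \<in> {\<one>\<^bsub>stability_group\<^esub>}"
    by (simp add: stability_group_def BijGroup_def)
qed

lemma nilpotent_stability_group: "nilpotent_group stability_group"
proof -
  interpret S: group stability_group
    by (rule group_stability_group)
  have "lower_central stability_group n \<subseteq> {\<one>\<^bsub>stability_group\<^esub>}"
    using lower_central_stability_group[of n] stab_top[of 1] by simp
  moreover have "\<one>\<^bsub>stability_group\<^esub> \<in> lower_central stability_group n"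
    by (cases n) (auto intro: generate.one)
  ultimately show ?thesis
    using group_stability_group by (auto simp: nilpotent_group_def)
qed

lemma finite_stability_group:
  assumes "finite (carrier G)"
  shows "finite (carrier stability_group)"
proof (rule finite_subset)
  show "carrier stability_group \<subseteq> carrier G \<rightarrow>\<^sub>E carrier G"
    using auto_closed[OF stab_auto] Bij_imp_extensional[OF auto_Bij[OF stab_auto]]
    by (auto simp: stability_group_def PiE_def)
  show "finite (carrier G \<rightarrow>\<^sub>E carrier G)"
    using assms by (simp add: finite_PiE)
qed

end

section \<open>Transport of finite nilpotent groups to carriers of natural numbers\<close>

text \<open>The inclusion in the carrier goes through the same induction because
  \<open>generate_img\<close> needs the commutators to lie in the carrier.\<close>

lemma lower_central_iso:
  assumes G: "group G" and H: "group H" and h: "h \<in> iso G H"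
  shows "lower_central H n = h ` lower_central G n \<and> lower_central G n \<subseteq> carrier G"
proof (induction n)
  case 0
  then show ?case
    using h by (auto simp: iso_def bij_betw_def)
next
  case (Suc n)
  interpret h: group_hom G H h
    using G H h by (simp add: group_hom_def group_hom_axioms_def iso_def)
  let ?c = "\<Union>x \<in> lower_central G n. \<Union>y \<in> carrier G.
        {x \<otimes>\<^bsub>G\<^esub> y \<otimes>\<^bsub>G\<^esub> inv\<^bsub>G\<^esub> x \<otimes>\<^bsub>G\<^esub> inv\<^bsub>G\<^esub> y}"
  have sub: "?c \<subseteq> carrier G"
    using Suc by blast
  have "carrier H = h ` carrier G"
    using h by (auto simp: iso_def bij_betw_def)
  then have "(\<Union>x \<in> lower_central H n. \<Union>y \<in> carrier H.
        {x \<otimes>\<^bsub>H\<^esub> y \<otimes>\<^bsub>H\<^esub> inv\<^bsub>H\<^esub> x \<otimes>\<^bsub>H\<^esub> inv\<^bsub>H\<^esub> y}) = h ` ?c"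
    using Suc by (simp add: image_UN subset_iff cong: SUP_cong)
  then show ?case
    using h.generate_img[OF sub] h.G.generate_in_carrier[OF sub] by auto
qed

text \<open>The represented pseudovariety has only members on \<open>nat\<close>, so a stability
  group, whose elements are functions, enters it through an isomorphic copy.\<close>

lemma finite_nilpotent_nat_copy:
  assumes "finite (carrier H)" and "nilpotent_group H"
  obtains K e where "K \<in> finite_nilpotent_groups" "e \<in> iso H K"
proof -
  interpret H: group H
    using assms by (simp add: nilpotent_group_def)
  obtain e :: "'a \<Rightarrow> nat" where e: "inj_on e (carrier H)"
    using finite_imp_inj_to_nat_seg[OF assms(1)] by blast
  define i where "i = inv_into (carrier H) e"
  define K where "K = \<lparr>carrier = e ` carrier H, monoid.mult = (\<lambda>x y. e (i x \<otimes>\<^bsub>H\<^esub> i y)), one = e \<one>\<^bsub>H\<^esub>\<rparr>"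
  have ie: "i (e x) = x" if "x \<in> carrier H" for x
    using e that by (simp add: i_def)
  have iso: "e \<in> iso H K"
    using e by (auto simp: iso_def hom_def K_def ie bij_betw_def)
  have K: "group K"
    using H.iso_imp_img_group[OF iso] by (simp add: K_def)
  have fin: "finite (carrier K)"
    using assms(1) by (simp add: K_def)
  interpret e: group_hom H K e
    using iso K by (simp add: group_hom_def group_hom_axioms_def iso_def H.is_group)
  obtain n where "lower_central H n = {\<one>\<^bsub>H\<^esub>}"
    using assms by (auto simp: nilpotent_group_def)
  then have "lower_central K n = {\<one>\<^bsub>K\<^esub>}"
    using lower_central_iso[OF H.is_group K iso, of n] by simp
  then have "K \<in> finite_nilpotent_groups"
    using K fin unfolding finite_nilpotent_groups_def nilpotent_group_def by blast
  then show ?thesis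
    using iso that by blast
qed

section \<open>Commuting elements of free groups\<close>

lemma carrier_free_group: "w \<in> carrier (free_group X) \<longleftrightarrow> reduced w \<and> fst ` set w \<subseteq> X"
  by (simp add: free_group_def)

lemma mult_free_group: "u \<otimes>\<^bsub>free_group X\<^esub> v = foldr cancel_Cons u v"
  by (simp add: free_group_def)

lemma one_free_group: "\<one>\<^bsub>free_group X\<^esub> = []"
  by (simp add: free_group_def)

lemma inv_free_group:
  assumes "w \<in> carrier (free_group X)"
  shows "inv\<^bsub>free_group X\<^esub> w = rev (map inv_letter w)"
proof (rule group.inv_equality[OF group_free_group])
  show "rev (map inv_letter w) \<otimes>\<^bsub>free_group X\<^esub> w = \<one>\<^bsub>free_group X\<^esub>"
    using assms foldr_cancel_Cons_inverse[of "[]" w] foldr_cancel_Cons_Nil[of w]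
    by (simp add: mult_free_group one_free_group carrier_free_group reduced_def)
  show "rev (map inv_letter w) \<in> carrier (free_group X)"
    using assms by (auto simp: carrier_free_group reduced_inverse inv_letter_def)
qed (fact assms)

lemma inv_letter_neq: "inv_letter a \<noteq> a"
  by (metis inv_letter_def snd_conv)

lemma reduced_append:
  "reduced (u @ v) \<longleftrightarrow> reduced u \<and> reduced v \<and> (u = [] \<or> v = [] \<or> hd v \<noteq> inv_letter (last u))"
  by (auto simp: reduced_def successively_append_iff)

lemma foldr_cancel_Cons_append: "reduced (u @ v) \<Longrightarrow> foldr cancel_Cons u v = u @ v"
proof (induction u)
  case (Cons a u)
  then have "reduced (u @ v)"
    by (auto simp: reduced_def successively_Cons)
  with Cons show ?case
    by (cases "u @ v") (auto simp: reduced_def)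
qed simp

lemma length_cancel_Cons: "length (cancel_Cons a w) \<le> Suc (length w)"
  by (cases w) auto

lemma length_foldr_cancel_Cons: "length (foldr cancel_Cons u v) \<le> length u + length v"
proof (induction u)
  case (Cons a u)
  then show ?case
    using length_cancel_Cons[of a "foldr cancel_Cons u v"] by simp
qed simp

text \<open>Any cancellation makes the product shorter. This detects from \<open>u v = v u\<close>
  that \<open>u v\<close> is free of cancellation as soon as \<open>v u\<close> is.\<close>

lemma foldr_cancel_Cons_length_eq:
  "length (foldr cancel_Cons u v) = length u + length v \<Longrightarrow> foldr cancel_Cons u v = u @ v"
proof (induction u)
  case (Cons a u)
  let ?w = "foldr cancel_Cons u v"
  have "length ?w = length u + length v" and "length (cancel_Cons a ?w) = Suc (length ?w)"
    using Cons.prems length_cancel_Cons[of a ?w] length_foldr_cancel_Cons[of u v] by auto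
  moreover from this have "?w = u @ v"
    using Cons.IH by simp
  ultimately show ?case
    by (cases "u @ v") (auto split: if_splits)
qed simp

lemma nat_pow_concat_replicate:
  assumes "z \<in> carrier (free_group X)"
  shows "reduced (concat (replicate n z)) \<Longrightarrow> z [^]\<^bsub>free_group X\<^esub> n = concat (replicate n z)"
proof (induction n)
  case 0
  show ?case
    by (simp add: one_free_group)
next
  case (Suc n)
  interpret group "free_group X"
    by (rule group_free_group)
  have "reduced (concat (replicate n z))"
    using Suc.prems by (simp add: reduced_append)
  then show ?case
    using Suc assms by (simp only: nat_pow_Suc2 mult_free_group)
      (simp add: foldr_cancel_Cons_append)
qed

text \<open>Both products have full length, so \<open>u\<close> and \<open>v\<close> commute as
  words under concatenation. Commuting words are powers of a common word.\<close>

lemma commuting_reduced_append: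
  assumes u: "u \<in> carrier (free_group X)" and v: "v \<in> carrier (free_group X)"
    and comm: "u \<otimes>\<^bsub>free_group X\<^esub> v = v \<otimes>\<^bsub>free_group X\<^esub> u"
    and red: "reduced (v @ u)" and "v \<noteq> []"
  shows "\<exists>z\<in>carrier (free_group X). \<exists>(k::int) (m::int). u = z [^]\<^bsub>free_group X\<^esub> k \<and> v = z [^]\<^bsub>free_group X\<^esub> m"
proof -
  have vu: "foldr cancel_Cons v u = v @ u"
    using red by (rule foldr_cancel_Cons_append)
  then have "foldr cancel_Cons u v = u @ v"
    using comm by (intro foldr_cancel_Cons_length_eq) (simp add: mult_free_group)
  then have "v @ u = u @ v"
    using comm vu by (simp add: mult_free_group)
  then obtain m n z where z: "concat (replicate m z) = v" "concat (replicate n z) = u"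
    using comm_append_are_replicate by blast
  \<comment> \<open>As \<open>v\<close> is nonempty, \<open>z\<close> is a prefix of it and is
    therefore itself a reduced word over \<open>X\<close>.\<close>
  have "m \<noteq> 0"
    using z(1) \<open>v \<noteq> []\<close> by (cases m) auto
  then obtain l where "v = z @ concat (replicate l z)"
    using z(1) by (cases m) auto
  then have "z \<in> carrier (free_group X)"
    using v by (auto simp: carrier_free_group reduced_append)
  moreover from this have "u = z [^]\<^bsub>free_group X\<^esub> int n" "v = z [^]\<^bsub>free_group X\<^esub> int m"
    using z u v by (simp_all add: int_pow_int nat_pow_concat_replicate carrier_free_group)
  ultimately show ?thesis
    by blast
qed

text \<open>After a cyclic reduction of \<open>v\<close> by conjugation, one of \<open>v u\<close> and \<open>v\<inverse> u\<close> is a product without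
  cancellation, so commutation is an equality of words.\<close>

lemma commuting_free_group:
  assumes "u \<in> carrier (free_group X)" and "v \<in> carrier (free_group X)"
    and "u \<otimes>\<^bsub>free_group X\<^esub> v = v \<otimes>\<^bsub>free_group X\<^esub> u"
  shows "\<exists>z\<in>carrier (free_group X). \<exists>(k::int) (m::int). u = z [^]\<^bsub>free_group X\<^esub> k \<and> v = z [^]\<^bsub>free_group X\<^esub> m"
  using assms
proof (induction v arbitrary: u rule: length_induct)
  case (1 v)
  define F where "F = free_group X"
  interpret group F
    unfolding F_def by (rule group_free_group)
  note u = 1(2)[folded F_def] and v = 1(3)[folded F_def] and comm = 1(4)[folded F_def]
  have trivial: ?case if "u = [] \<or> v = []"
  proof -
    have "u = \<one>\<^bsub>F\<^esub> \<or> v = \<one>\<^bsub>F\<^esub>"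
      using that by (simp add: F_def one_free_group)
    moreover have "\<exists>z\<in>carrier F. \<exists>(k::int) (m::int). u = z [^]\<^bsub>F\<^esub> k \<and> v = z [^]\<^bsub>F\<^esub> m" if "u = \<one>\<^bsub>F\<^esub>"
      using v that by (intro bexI[of _ v] exI[of _ 0] exI[of _ 1]) auto
    moreover have "\<exists>z\<in>carrier F. \<exists>(k::int) (m::int). u = z [^]\<^bsub>F\<^esub> k \<and> v = z [^]\<^bsub>F\<^esub> m" if "v = \<one>\<^bsub>F\<^esub>"
      using u that by (intro bexI[of _ u] exI[of _ 1] exI[of _ 0]) auto
    ultimately show ?thesis
      unfolding F_def by blast
  qed
  show ?case
  proof (cases "u = [] \<or> v = []")
    case False
    then have ne: "u \<noteq> []" "v \<noteq> []"
      by auto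
    have ru: "reduced u" and rv: "reduced v"
      using u v by (auto simp: F_def carrier_free_group)
    show ?thesis
    proof (cases "hd v = inv_letter (last v)")
      case True
      \<comment> \<open>Here \<open>v\<close> is \<open>a v' a^-1\<close> without cancellation.
        Undoing the conjugation leaves a commuting pair \<open>u'\<close>, \<open>v'\<close> in
        which \<open>v'\<close> is shorter by two letters.\<close>
      define a where "a = [hd v]"
      have a: "a \<in> carrier F"
        using v ne by (auto simp: a_def F_def carrier_free_group reduced_def)
      obtain v'' where v'': "v = hd v # v''"
        using ne by (cases v) auto
      then have "v'' \<noteq> []"
        using True inv_letter_neq by (metis last.simps)
      define v' where "v' = butlast v''"
      have v_eq: "v = hd v # v' @ [inv_letter (hd v)]"
        using v'' \<open>v'' \<noteq> []\<close> True unfolding v'_def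
        by (metis append_butlast_last_id inv_letter_inv_letter last_ConsR)
      have v': "v' \<in> carrier F"
        using v v_eq unfolding F_def carrier_free_group
        by (metis (no_types, lifting) append_Cons append_Nil image_mono le_supE reduced_append set_append subset_trans set_subset_Cons)
      have ia: "inv\<^bsub>F\<^esub> a = [inv_letter (hd v)]"
        using a by (simp add: F_def inv_free_group a_def)
      have rv': "reduced (v' @ [inv_letter (hd v)])"
        using rv v_eq by (metis append_Cons append_Nil reduced_append)
      then have "v' \<otimes>\<^bsub>F\<^esub> inv\<^bsub>F\<^esub> a = v' @ [inv_letter (hd v)]"
        by (simp only: F_def mult_free_group ia[unfolded F_def] foldr_cancel_Cons_append)
      moreover have "a \<otimes>\<^bsub>F\<^esub> (v' @ [inv_letter (hd v)]) = a @ (v' @ [inv_letter (hd v)])"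
        using rv v_eq unfolding F_def mult_free_group a_def
        by (intro foldr_cancel_Cons_append) simp
      ultimately have conj: "v = a \<otimes>\<^bsub>F\<^esub> v' \<otimes>\<^bsub>F\<^esub> inv\<^bsub>F\<^esub> a"
        using a v' v_eq by (simp add: m_assoc a_def)
      define u' where "u' = inv\<^bsub>F\<^esub> a \<otimes>\<^bsub>F\<^esub> u \<otimes>\<^bsub>F\<^esub> a"
      have u': "u' \<in> carrier F"
        using u a by (simp add: u'_def)
      have cancel: "a \<otimes>\<^bsub>F\<^esub> (inv\<^bsub>F\<^esub> a \<otimes>\<^bsub>F\<^esub> x) = x" if "x \<in> carrier F" for x
        using a that by (simp add: m_assoc[symmetric])
      have u_eq: "u = a \<otimes>\<^bsub>F\<^esub> u' \<otimes>\<^bsub>F\<^esub> inv\<^bsub>F\<^esub> a"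
        using u a by (simp add: u'_def m_assoc cancel)
      have conj_mult: "(a \<otimes>\<^bsub>F\<^esub> x \<otimes>\<^bsub>F\<^esub> inv\<^bsub>F\<^esub> a) \<otimes>\<^bsub>F\<^esub> (a \<otimes>\<^bsub>F\<^esub> y \<otimes>\<^bsub>F\<^esub> inv\<^bsub>F\<^esub> a) = a \<otimes>\<^bsub>F\<^esub> (x \<otimes>\<^bsub>F\<^esub> y) \<otimes>\<^bsub>F\<^esub> inv\<^bsub>F\<^esub> a"
        if "x \<in> carrier F" "y \<in> carrier F" for x y
      proof -
        have "inv\<^bsub>F\<^esub> a \<otimes>\<^bsub>F\<^esub> (a \<otimes>\<^bsub>F\<^esub> (y \<otimes>\<^bsub>F\<^esub> inv\<^bsub>F\<^esub> a)) = y \<otimes>\<^bsub>F\<^esub> inv\<^bsub>F\<^esub> a"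
          using that a by (simp add: m_assoc[symmetric])
        then show ?thesis
          using that a by (simp add: m_assoc)
      qed
      have "u' \<otimes>\<^bsub>F\<^esub> v' = v' \<otimes>\<^bsub>F\<^esub> u'"
        using comm u' v' a conj_mult[OF u' v'] conj_mult[OF v' u'] by (simp add: u_eq[symmetric] conj[symmetric])
      moreover have "length v' < length v"
        by (subst v_eq) simp
      ultimately obtain z k m where z: "z \<in> carrier F" "u' = z [^]\<^bsub>F\<^esub> (k::int)" "v' = z [^]\<^bsub>F\<^esub> (m::int)"
        using 1(1) u' v' unfolding F_def by blast
      define y where "y = a \<otimes>\<^bsub>F\<^esub> z \<otimes>\<^bsub>F\<^esub> inv\<^bsub>F\<^esub> a"
      \<comment> \<open>Conjugation by \<open>a\<close> is a homomorphism, so it carries the common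
        root \<open>z\<close> of \<open>u'\<close> and \<open>v'\<close> to a common root of
        \<open>u\<close> and \<open>v\<close>.\<close>
      have "(\<lambda>x. a \<otimes>\<^bsub>F\<^esub> x \<otimes>\<^bsub>F\<^esub> inv\<^bsub>F\<^esub> a) \<in> hom F F"
        using a conj_mult by (auto simp: hom_def)
      then have "group_hom F F (\<lambda>x. a \<otimes>\<^bsub>F\<^esub> x \<otimes>\<^bsub>F\<^esub> inv\<^bsub>F\<^esub> a)"
        by (simp add: group_hom_def group_hom_axioms_def is_group)
      from group_hom.hom_int_pow[OF this z(1)]
      have "y [^]\<^bsub>F\<^esub> i = a \<otimes>\<^bsub>F\<^esub> z [^]\<^bsub>F\<^esub> i \<otimes>\<^bsub>F\<^esub> inv\<^bsub>F\<^esub> a" for i :: int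
        by (simp add: y_def)
      then have "u = y [^]\<^bsub>F\<^esub> k" "v = y [^]\<^bsub>F\<^esub> m"
        using z u_eq conj by simp_all
      moreover have "y \<in> carrier F"
        using a z by (simp add: y_def)
      ultimately show ?thesis
        unfolding F_def by blast
    next
      case cyc: False
      show ?thesis
      proof (cases "hd u = inv_letter (last v)")
        case False
        then have "reduced (v @ u)"
          using ru rv by (simp add: reduced_append)
        then show ?thesis
          using commuting_reduced_append[of u X v] u v comm ne by (simp add: F_def)
      next
        case True
        \<comment> \<open>The last letter of \<open>v^-1\<close> is the inverse of
          \<open>hd v\<close>, so \<open>v^-1 u\<close> could cancel only if
          \<open>hd u = hd v\<close>. But \<open>hd u\<close> is the inverse of
          \<open>last v\<close>, which differs from \<open>hd v\<close> because \<open>v\<close> is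
          cyclically reduced.\<close>
        define v' where "v' = inv\<^bsub>F\<^esub> v"
        have v': "v' \<in> carrier F"
          using v by (simp add: v'_def)
        have v'_eq: "v' = rev (map inv_letter v)"
          using v by (simp add: v'_def F_def inv_free_group)
        have "last v' = inv_letter (hd v)"
          using ne by (simp add: v'_eq last_rev hd_map)
        then have "reduced (v' @ u)"
          using ru reduced_inverse[OF rv] cyc True by (simp add: reduced_append v'_eq)
        moreover have "u \<otimes>\<^bsub>F\<^esub> v' = v' \<otimes>\<^bsub>F\<^esub> u"
        proof -
          have "v \<otimes>\<^bsub>F\<^esub> (u \<otimes>\<^bsub>F\<^esub> v') = u \<otimes>\<^bsub>F\<^esub> v \<otimes>\<^bsub>F\<^esub> v'"
            using u v v' comm by (simp add: m_assoc)
          also have "\<dots> = u"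
            using u v by (simp add: v'_def m_assoc)
          finally show ?thesis
            using u v unfolding v'_def by (intro inv_solve_left[THEN iffD2]) auto
        qed
        moreover have "v' \<noteq> []"
          using ne by (simp add: v'_eq)
        ultimately obtain z k m where z: "z \<in> carrier F" "u = z [^]\<^bsub>F\<^esub> (k::int)" "v' = z [^]\<^bsub>F\<^esub> (m::int)"
          using commuting_reduced_append[of u X v'] u v' by (auto simp: F_def)
        then have "v = z [^]\<^bsub>F\<^esub> (- m)"
          using v by (simp add: int_pow_neg) (simp add: v'_def flip: z(3))
        then show ?thesis
          using z(1,2) unfolding F_def by blast
      qed
    qed
  qed (use trivial in blast)
qed

section \<open>The unitriangular action\<close>

text \<open>The letter \<open>(x, True)\<close> acts on integer vectors as the identity plus the elementary matrices
  in the superdiagonal positions \<open>(i, i + 1)\<close> with \<open>gs ! i = x\<close>.\<close>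

definition shift :: "'b list \<Rightarrow> 'b letter \<Rightarrow> (nat \<Rightarrow> int) \<Rightarrow> nat \<Rightarrow> int" where
  "shift gs a v i =
     v i + (if i < length gs \<and> gs ! i = fst a then if snd a then v (Suc i) else - v (Suc i) else 0)"

definition act :: "'b list \<Rightarrow> 'b letter list \<Rightarrow> (nat \<Rightarrow> int) \<Rightarrow> nat \<Rightarrow> int" where
  "act gs w = foldr (shift gs) w"

text \<open>The relevant coordinates run from 0 to \<open>length gs\<close>, one more than the
  number of superdiagonal positions; \<open>shift\<close> never alters the top one.\<close>

definition last_unit :: "'b list \<Rightarrow> nat \<Rightarrow> int" where
  "last_unit gs i = (if i = length gs then 1 else 0)"

lemma act_Nil [simp]: "act gs [] v = v"
  by (simp add: act_def)

lemma act_Cons [simp]: "act gs (a # w) v = shift gs a (act gs w v)"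
  by (simp add: act_def)

lemma distinct_adj_nth: "distinct_adj xs \<Longrightarrow> Suc i < length xs \<Longrightarrow> xs ! i \<noteq> xs ! Suc i"
  by (simp add: distinct_adj_conv_nth)

text \<open>Neighbouring positions carry different generators, so the nilpotent part
  \<open>N\<close> of a letter satisfies \<open>N^2 = 0\<close>, and \<open>1 - N\<close> is inverse
  to \<open>1 + N\<close>.\<close>

lemma shift_inverse:
  assumes "distinct_adj gs"
  shows "shift gs a (shift gs (inv_letter a) v) = v"
proof
  fix i
  show "shift gs a (shift gs (inv_letter a) v) i = v i"
    using distinct_adj_nth[OF assms, of i] by (auto simp: shift_def inv_letter_def)
qed

lemma act_cancel_Cons:
  assumes "distinct_adj gs"
  shows "act gs (cancel_Cons a w) v = shift gs a (act gs w v)"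
  using shift_inverse[OF assms] by (cases w) auto

lemma act_mult:
  assumes "distinct_adj gs"
  shows "act gs (foldr cancel_Cons u v) x = act gs u (act gs v x)"
  by (induction u) (simp_all add: act_cancel_Cons[OF assms])

lemma act_inverse:
  assumes "distinct_adj gs" "reduced w"
  shows "act gs w (act gs (rev (map inv_letter w)) x) = x"
    and "act gs (rev (map inv_letter w)) (act gs w x) = x"
proof -
  have "foldr cancel_Cons (rev (map inv_letter u)) u = []" if "reduced u" for u :: "'a letter list"
    using foldr_cancel_Cons_inverse[of "[]" u] foldr_cancel_Cons_Nil[OF that] by (simp add: reduced_def)
  note inverse = this
  show "act gs (rev (map inv_letter w)) (act gs w x) = x"
    using act_mult[OF assms(1), of "rev (map inv_letter w)" w x] inverse[OF assms(2)] by simp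
  have "rev (map inv_letter (rev (map inv_letter w))) = w"
    by (simp add: rev_map[symmetric] map_idI)
  then show "act gs w (act gs (rev (map inv_letter w)) x) = x"
    using act_mult[OF assms(1), of w "rev (map inv_letter w)" x]
      inverse[OF reduced_inverse[OF assms(2)]] by simp
qed

lemma act_add: "act gs w (\<lambda>i. u i + v i) = (\<lambda>i. act gs w u i + act gs w v i)"
  by (induction w) (auto simp: shift_def)

text \<open>Coordinates up to \<open>length gs\<close> receive nothing from beyond, so the action
  descends to vectors modulo \<open>q\<close> with \<open>length gs + 1\<close> entries.\<close>

lemma act_mod_cong:
  assumes "\<And>i. i \<le> length gs \<Longrightarrow> u i mod q = v i mod q" and "i \<le> length gs"
  shows "act gs w u i mod q = act gs w v i mod q"
  using assms(2)
proof (induction w arbitrary: i)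
  case (Cons a w)
  let ?u = "act gs w u" and ?v = "act gs w v"
  have IH: "?u i mod q = ?v i mod q" and Suc: "i < length gs \<Longrightarrow> ?u (Suc i) mod q = ?v (Suc i) mod q"
    using Cons by auto
  then show ?case
    using Cons.prems by (auto simp: shift_def intro: mod_add_cong mod_diff_cong)
qed (use assms(1) in auto)

text \<open>Unitriangularity: a letter alters coordinate \<open>j\<close> at most by plus or minus
  coordinate \<open>j + 1\<close>, so the total change there is determined by the coordinates above
  \<open>j\<close>.\<close>

lemma act_upper:
  assumes "\<And>j. i < j \<Longrightarrow> j \<le> length gs \<Longrightarrow> u j = v j" and "i \<le> j" "j \<le> length gs"
  shows "act gs w u j - u j = act gs w v j - v j"
  using assms(2,3)
proof (induction w arbitrary: j)
  case (Cons a w)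
  have "act gs w u (Suc j) = act gs w v (Suc j)" if "j < length gs"
    using Cons.IH[of "Suc j"] Cons.prems assms(1)[of "Suc j"] that by simp
  then show ?case
    using Cons.IH[of j] Cons.prems by (auto simp: shift_def)
qed simp

lemma act_zero: "act gs w (\<lambda>_. 0) = (\<lambda>_. 0)"
  by (induction w) (auto simp: shift_def)

text \<open>Reading \<open>w\<close> from the right, each syllable makes one more coordinate nonzero; within a syllable
  all letters agree by reducedness, so that coordinate keeps its sign.\<close>

lemma act_last_unit_suffix:
  assumes "distinct_adj gs" "reduced u" "u \<noteq> []" "k < length gs"
    and "remdups_adj (map fst u) = drop k gs"
  defines "v \<equiv> act gs u (last_unit gs)"
  shows "(\<forall>i<k. v i = 0) \<and> (if snd (hd u) then v k * v (Suc k) > 0 else v k * v (Suc k) < 0)"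
  using assms(2-5) unfolding v_def
proof (induction u arbitrary: k)
  case (Cons a u)
  have gk: "gs ! k = fst a"
    using Cons.prems by (metis Cons_nth_drop_Suc list.sel(1) hd_remdups_adj list.map_sel(1) list.simps(3) list.simps(8))
  have gk1: "Suc k < length gs \<Longrightarrow> gs ! Suc k \<noteq> fst a"
    using distinct_adj_nth[OF assms(1), of k] gk by simp
  have gk0: "gs ! i \<noteq> fst a" if "Suc i = k" for i
    using distinct_adj_nth[OF assms(1), of i] gk that Cons.prems(3) by simp
  let ?v = "act gs u (last_unit gs)"
  show ?case
  proof (cases u)
    \<comment> \<open>The rightmost letter acts at position \<open>length gs - 1\<close>, where it
      picks up the entry 1 of \<open>last_unit\<close>.\<close>
    case Nil
    then have "drop k gs = [fst a]"
      using Cons.prems by simp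
    then have "length (drop k gs) = 1"
      by (simp only: list.size One_nat_def)
    then have "Suc k = length gs"
      unfolding length_drop by arith
    then show ?thesis
      using Nil gk by (auto simp: shift_def last_unit_def)
  next
    case (Cons b u')
    have red: "reduced u" and ba: "b \<noteq> inv_letter a"
      using Cons Cons.prems(1) by (auto simp: reduced_def)
    show ?thesis
    proof (cases "fst a = fst b")
      case True
      then have "b = a"
        using ba by (auto simp: inv_letter_def prod_eq_iff)
      have IH: "(\<forall>i<k. ?v i = 0) \<and> (if snd a then ?v k * ?v (Suc k) > 0 else ?v k * ?v (Suc k) < 0)"
      proof -
        have "remdups_adj (map fst u) = drop k gs" "u \<noteq> []" "hd u = a"
          using Cons.prems(4) Cons \<open>b = a\<close> by simp_all
        then show ?thesis
          using Cons.IH[OF red _ Cons.prems(3)] by presburger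
      qed
      \<comment> \<open>Position \<open>k - 1\<close> belongs to another generator, so the nonzero
        coordinate \<open>k\<close> is not copied down yet.\<close>
      have v0: "shift gs a ?v i = 0" if "i < k" for i
        using IH gk0[of i] that by (cases "Suc i = k") (auto simp: shift_def)
      have v1: "shift gs a ?v (Suc k) = ?v (Suc k)"
        using gk1 by (auto simp: shift_def)
      have vk: "shift gs a ?v k = ?v k + (if snd a then ?v (Suc k) else - ?v (Suc k))"
        using gk Cons.prems(3) by (simp add: shift_def)
      \<comment> \<open>The product of coordinates \<open>k\<close> and \<open>k + 1\<close> changes
        by plus or minus the square of coordinate \<open>k + 1\<close>, in the direction of its
        present sign.\<close>
      show ?thesis
        using v0 IH by (auto simp: v1 vk distrib_right left_diff_distrib split: if_splits
            intro: add_pos_nonneg order.strict_trans2[where b = 0])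
    next
      case False
      then have "fst a # remdups_adj (map fst u) = drop k gs"
        using Cons.prems(4) Cons by simp
      then have d: "remdups_adj (map fst u) = drop (Suc k) gs"
        by (metis drop_Suc list.sel(3) tl_drop)
      then have "Suc k < length gs"
        using Cons by (metis drop_eq_Nil list.map_disc_iff list.simps(3) not_le remdups_adj_Nil_iff)
      \<comment> \<open>A new syllable starts: coordinate \<open>k\<close> is still zero and
        coordinate \<open>k + 1\<close> is not, so the letter copies the latter into position
        \<open>k\<close> up to sign.\<close>
      then have IH: "(\<forall>i<Suc k. ?v i = 0) \<and> ?v (Suc k) \<noteq> 0"
        using Cons.IH[OF red _ _ d] Cons by (auto split: if_splits)
      have v1: "shift gs a ?v (Suc k) = ?v (Suc k)"
        using gk1 by (auto simp: shift_def)
      have vk: "shift gs a ?v k = (if snd a then ?v (Suc k) else - ?v (Suc k))"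
        using gk Cons.prems(3) IH by (simp add: shift_def)
      have "shift gs a ?v i = 0" if "i < k" for i
        using IH that by (auto simp: shift_def)
      moreover have "?v (Suc k) * ?v (Suc k) > 0"
        using IH by (auto simp: zero_less_mult_iff linorder_neq_iff)
      ultimately show ?thesis
        by (simp add: v1 vk)
    qed
  qed
qed simp

text \<open>With \<open>gs\<close> read off from \<open>w\<close> itself, the nonzero entries reach
  coordinate 0, where \<open>last_unit\<close> vanishes. So \<open>w\<close> acts
  nontrivially.\<close>

lemma act_last_unit_nonzero:
  assumes "reduced w" "w \<noteq> []"
  defines "gs \<equiv> remdups_adj (map fst w)"
  shows "gs \<noteq> [] \<and> act gs w (last_unit gs) 0 \<noteq> 0"
proof -
  have "gs \<noteq> []"
    using assms by simp
  have "distinct_adj gs" and "remdups_adj (map fst w) = drop 0 gs"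
    by (simp_all add: gs_def)
  then have "act gs w (last_unit gs) 0 * act gs w (last_unit gs) (Suc 0) \<noteq> 0"
    using act_last_unit_suffix[of gs w 0] assms(1,2) \<open>gs \<noteq> []\<close> by (metis length_greater_0_conv less_irrefl)
  then show ?thesis
    using \<open>gs \<noteq> []\<close> by simp
qed

text \<open>The coordinates above \<open>i\<close> stay fixed, so by \<open>act_upper\<close> every
  further application of \<open>z\<close> adds the same amount at \<open>i\<close>, and every
  application of its inverse subtracts it.\<close>

lemma act_int_pow:
  assumes gs: "distinct_adj gs" and z: "z \<in> carrier (free_group X)" and i: "i < length gs"
    and top: "\<And>j. i < j \<Longrightarrow> j \<le> length gs \<Longrightarrow> act gs z (last_unit gs) j = last_unit gs j"
  shows "(\<forall>j. i < j \<longrightarrow> j \<le> length gs \<longrightarrow>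
            act gs (z [^]\<^bsub>free_group X\<^esub> (n::int)) (last_unit gs) j = last_unit gs j)
       \<and> act gs (z [^]\<^bsub>free_group X\<^esub> n) (last_unit gs) i = n * act gs z (last_unit gs) i"
proof -
  define F where "F = free_group X"
  interpret group F
    unfolding F_def by (rule group_free_group)
  define e where "e = last_unit gs"
  define \<alpha> where "\<alpha> = act gs z e i"
  define E where "E c v \<longleftrightarrow> (\<forall>j. i < j \<longrightarrow> j \<le> length gs \<longrightarrow> v j = e j) \<and> v i = c" for c v
  have ei: "e i = 0"
    using i by (simp add: e_def last_unit_def)
  have zF: "z \<in> carrier F"
    using z by (simp add: F_def)
  have rz: "reduced z"
    using z by (simp add: carrier_free_group)
  have inv: "inv\<^bsub>F\<^esub> z = rev (map inv_letter z)"
    using z by (simp add: F_def inv_free_group)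
  have step: "E (c + act gs w e i) (act gs w v)"
    if v: "E c v" and w: "\<And>j. i < j \<Longrightarrow> j \<le> length gs \<Longrightarrow> act gs w e j = e j" for c v w
  proof -
    have "act gs w v j - v j = act gs w e j - e j" if "i \<le> j" "j \<le> length gs" for j
      using v that by (intro act_upper[of i gs v e]) (auto simp: E_def)
    note eq = this
    show ?thesis
      unfolding E_def using v w eq[OF less_imp_le] eq[of i] i ei by (auto simp: E_def)
  qed
  \<comment> \<open>\<open>act gs z e\<close> and \<open>e\<close> agree above \<open>i\<close>, so
    the inverse of \<open>z\<close> displaces both equally from \<open>i\<close> on; it takes the
    first one back to \<open>e\<close>.\<close>
  have inv_e: "e j - act gs z e j = act gs (inv\<^bsub>F\<^esub> z) e j - e j" if "i \<le> j" "j \<le> length gs" for j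
    using act_upper[of i gs "act gs z e" e j "inv\<^bsub>F\<^esub> z"] top that act_inverse(2)[OF gs rz, of e]
    by (simp add: inv e_def)
  have inv_top: "act gs (inv\<^bsub>F\<^esub> z) e j = e j" if "i < j" "j \<le> length gs" for j
    using inv_e[of j] top that by (simp add: e_def)
  have inv_i: "act gs (inv\<^bsub>F\<^esub> z) e i = - \<alpha>"
    using inv_e[of i] i ei by (simp add: \<alpha>_def)
  have "E (n * \<alpha>) (act gs (z [^]\<^bsub>F\<^esub> n) e)"
  proof (induction n rule: int_induct[where k = 0])
    case base
    then show ?case
      using ei by (simp add: E_def F_def one_free_group)
  next
    case (step1 n)
    have "z [^]\<^bsub>F\<^esub> (n + 1) = z \<otimes>\<^bsub>F\<^esub> z [^]\<^bsub>F\<^esub> n"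
      using int_pow_mult[OF zF, of 1 n] zF by (simp add: add.commute)
    then have "act gs (z [^]\<^bsub>F\<^esub> (n + 1)) e = act gs z (act gs (z [^]\<^bsub>F\<^esub> n) e)"
      by (simp add: F_def mult_free_group act_mult[OF gs])
    then show ?case
      using step[OF step1(2), of z] top by (simp add: \<alpha>_def e_def algebra_simps)
  next
    case (step2 n)
    have "z [^]\<^bsub>F\<^esub> (n - 1) = inv\<^bsub>F\<^esub> z \<otimes>\<^bsub>F\<^esub> z [^]\<^bsub>F\<^esub> n"
      using int_pow_mult[OF zF, of "- 1" n] zF by (simp add: int_pow_neg)
    then have "act gs (z [^]\<^bsub>F\<^esub> (n - 1)) e = act gs (inv\<^bsub>F\<^esub> z) (act gs (z [^]\<^bsub>F\<^esub> n) e)"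
      by (simp add: F_def mult_free_group act_mult[OF gs])
    then show ?case
      using step[OF step2(2), of "inv\<^bsub>F\<^esub> z"] inv_top inv_i by (simp add: algebra_simps)
  qed
  then show ?thesis
    by (simp add: E_def F_def e_def \<alpha>_def)
qed

section \<open>Reduction modulo \<open>q\<close>\<close>

definition vec_group :: "nat \<Rightarrow> nat \<Rightarrow> (nat \<Rightarrow> int) monoid" where
  "vec_group m q = product_group {..m} (\<lambda>_. integer_mod_group q)"

text \<open>The restriction to \<open>{..m}\<close> is there because the carrier of
  \<open>product_group\<close> consists of extensional functions.\<close>

definition red_vec :: "nat \<Rightarrow> nat \<Rightarrow> (nat \<Rightarrow> int) \<Rightarrow> nat \<Rightarrow> int" where
  "red_vec m q v = (\<lambda>i\<in>{..m}. v i mod int q)"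

text \<open>Superdiagonal matrices move coordinate \<open>i + 1\<close> into coordinate
  \<open>i\<close> and thus lower this chain by one step.\<close>

definition vec_chain :: "nat \<Rightarrow> nat \<Rightarrow> nat \<Rightarrow> (nat \<Rightarrow> int) set" where
  "vec_chain m q j = {v \<in> carrier (vec_group m q). \<forall>i. j \<le> i \<longrightarrow> i \<le> m \<longrightarrow> v i = 0}"

definition act_mod :: "nat \<Rightarrow> 'b list \<Rightarrow> 'b letter list \<Rightarrow> (nat \<Rightarrow> int) \<Rightarrow> nat \<Rightarrow> int" where
  "act_mod q gs w = (\<lambda>v \<in> carrier (vec_group (length gs) q). red_vec (length gs) q (act gs w v))"

lemma comm_group_vec_group: "comm_group (vec_group m q)"
proof (rule group.group_comm_groupI)
  show "group (vec_group m q)"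
    by (simp add: vec_group_def)
qed (auto simp: vec_group_def add.commute)

lemma carrier_vec_group: "q > 0 \<Longrightarrow> carrier (vec_group m q) = {..m} \<rightarrow>\<^sub>E {0..<int q}"
  by (simp add: vec_group_def carrier_integer_mod_group)

lemma red_vec_closed: "q > 0 \<Longrightarrow> red_vec m q v \<in> carrier (vec_group m q)"
  by (auto simp: carrier_vec_group red_vec_def)

lemma red_vec_ident:
  assumes "q > 0" "v \<in> carrier (vec_group m q)"
  shows "red_vec m q v = v"
proof
  fix i show "red_vec m q v i = v i"
    using assms PiE_arb[of v "{..m}" "\<lambda>_. {0..<int q}" i] PiE_mem[of v "{..m}" "\<lambda>_. {0..<int q}" i]
    by (simp add: carrier_vec_group red_vec_def)
qed

lemma mult_vec_group: "u \<otimes>\<^bsub>vec_group m q\<^esub> v = red_vec m q (\<lambda>i. u i + v i)"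
  by (simp add: vec_group_def red_vec_def)

lemma one_vec_group: "\<one>\<^bsub>vec_group m q\<^esub> = (\<lambda>i\<in>{..m}. 0)"
  by (simp add: vec_group_def)

lemma inv_vec_group:
  assumes "v \<in> carrier (vec_group m q)"
  shows "inv\<^bsub>vec_group m q\<^esub> v = red_vec m q (\<lambda>i. - v i)"
proof -
  have "\<And>i. i \<le> m \<Longrightarrow> v i \<in> carrier (integer_mod_group q)"
    using assms by (auto simp: vec_group_def PiE_mem)
  then show ?thesis
    using assms by (auto simp: vec_group_def red_vec_def cong: restrict_cong)
qed

lemma red_vec_eqI: "(\<And>i. i \<le> m \<Longrightarrow> u i mod int q = v i mod int q) \<Longrightarrow> red_vec m q u = red_vec m q v"
  by (auto simp: red_vec_def)

lemma red_vec_act_red_vec: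
  "red_vec (length gs) q (act gs w (red_vec (length gs) q v)) = red_vec (length gs) q (act gs w v)"
  by (intro red_vec_eqI act_mod_cong) (auto simp: red_vec_def)

lemma act_mod_red_vec:
  "q > 0 \<Longrightarrow> act_mod q gs w (red_vec (length gs) q v) = red_vec (length gs) q (act gs w v)"
  by (simp add: act_mod_def red_vec_closed red_vec_act_red_vec)

lemma group_chain_vec_chain:
  assumes "q > 0"
  shows "group_chain (vec_group m q) (vec_chain m q) (Suc m)"
proof -
  interpret comm_group "vec_group m q"
    by (rule comm_group_vec_group)
  show ?thesis
  proof (intro group_chain.intro group_chain_axioms.intro comm_group_vec_group)
    fix j
    show "subgroup (vec_chain m q j) (vec_group m q)"
    proof (rule subgroupI)
      show "vec_chain m q j \<subseteq> carrier (vec_group m q)"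
        by (auto simp: vec_chain_def)
      have "\<one>\<^bsub>vec_group m q\<^esub> \<in> vec_chain m q j"
        using one_closed by (auto simp: vec_chain_def one_vec_group)
      then show "vec_chain m q j \<noteq> {}"
        by blast
    next
      fix v assume "v \<in> vec_chain m q j"
      then show "inv\<^bsub>vec_group m q\<^esub> v \<in> vec_chain m q j"
        using red_vec_closed[OF assms]
        by (auto simp: vec_chain_def inv_vec_group) (auto simp: red_vec_def)
    next
      fix u v assume "u \<in> vec_chain m q j" "v \<in> vec_chain m q j"
      then show "u \<otimes>\<^bsub>vec_group m q\<^esub> v \<in> vec_chain m q j"
        using red_vec_closed[OF assms]
        by (auto simp: vec_chain_def mult_vec_group) (auto simp: red_vec_def)
    qed
    show "vec_chain m q j \<subseteq> vec_chain m q (Suc j)"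
      by (auto simp: vec_chain_def)
  next
    have zero: "v = (\<lambda>i\<in>{..m}. 0)" if "v \<in> carrier (vec_group m q)" "\<forall>i\<le>m. v i = 0" for v
      using that by (intro ext) (auto simp: carrier_vec_group[OF assms] PiE_def extensional_def)
    show "vec_chain m q 0 = {\<one>\<^bsub>vec_group m q\<^esub>}"
    proof (intro equalityI subsetI)
      fix v assume "v \<in> vec_chain m q 0"
      then show "v \<in> {\<one>\<^bsub>vec_group m q\<^esub>}"
        unfolding one_vec_group using zero[of v] by (simp add: vec_chain_def)
    next
      fix v assume "v \<in> {\<one>\<^bsub>vec_group m q\<^esub>}"
      then show "v \<in> vec_chain m q 0"
        using one_closed by (simp add: vec_chain_def one_vec_group)
    qed
    show "vec_chain m q (Suc m) = carrier (vec_group m q)"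
      by (auto simp: vec_chain_def)
  qed
qed

lemma act_mod_stability_group:
  assumes q: "q > 0" and gs: "distinct_adj gs" and w: "reduced w"
  shows "act_mod q gs w \<in> carrier
    (group_chain.stability_group (vec_group (length gs) q) (vec_chain (length gs) q))"
proof -
  define m where "m = length gs"
  define A where "A = vec_group m q"
  interpret group_chain A "vec_chain m q" "Suc m"
    unfolding A_def using q by (rule group_chain_vec_chain)
  have val: "act_mod q gs w v = red_vec m q (act gs w v)" if "v \<in> carrier A" for v
    using that by (simp add: act_mod_def m_def A_def)
  have closed: "act_mod q gs w v \<in> carrier A" if "v \<in> carrier A" for w v
    using that red_vec_closed[OF q] by (simp add: act_mod_def m_def A_def)
  have inverse: "act_mod q gs w (act_mod q gs w' v) = v"
    if "v \<in> carrier A" "act gs w (act gs w' v) = v" for w w' v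
    using that q
    by (simp add: act_mod_def red_vec_closed red_vec_act_red_vec A_def m_def red_vec_ident)
  have "bij_betw (act_mod q gs w) (carrier A) (carrier A)"
    using closed inverse act_inverse[OF gs w]
    by (intro bij_betw_byWitness[where f' = "act_mod q gs (rev (map inv_letter w))"]) auto
  then have "act_mod q gs w \<in> Bij (carrier A)"
    by (simp add: Bij_def act_mod_def A_def m_def)
  moreover have "act_mod q gs w \<in> hom A A"
  proof (rule homI)
    fix u v assume "u \<in> carrier A" "v \<in> carrier A"
    then show "act_mod q gs w (u \<otimes>\<^bsub>A\<^esub> v) = act_mod q gs w u \<otimes>\<^bsub>A\<^esub> act_mod q gs w v"
      using q act_mod_red_vec[OF q, of gs w "\<lambda>i. u i + v i"]
      by (simp add: val mult_vec_group A_def m_def act_add)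
        (auto intro!: red_vec_eqI simp: red_vec_def mod_simps)
  qed (rule closed)
  ultimately have auto: "act_mod q gs w \<in> auto A"
    by (simp add: auto_def)
  have "act_mod q gs w v \<otimes>\<^bsub>A\<^esub> inv\<^bsub>A\<^esub> v \<in> vec_chain m q (j - 1)" if v: "v \<in> vec_chain m q j" for v j
  proof -
    have vA: "v \<in> carrier A"
      using v by (simp add: vec_chain_def A_def)
    \<comment> \<open>By comparison with the zero vector: all coordinates above \<open>j - 1\<close>
      vanish, so coordinates from \<open>j - 1\<close> on do not move.\<close>
    have "act gs w v i = v i" if "j - 1 \<le> i" "i \<le> m" for i
      using act_upper[of "j - 1" gs v "\<lambda>_. 0" i w] v that
      by (simp add: vec_chain_def act_zero m_def)
    then have "(act_mod q gs w v \<otimes>\<^bsub>A\<^esub> inv\<^bsub>A\<^esub> v) i = 0" if "j - 1 \<le> i" "i \<le> m" for i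
      using that vA by (simp add: val mult_vec_group A_def inv_vec_group red_vec_def mod_simps)
    moreover have "act_mod q gs w v \<otimes>\<^bsub>A\<^esub> inv\<^bsub>A\<^esub> v \<in> carrier A"
      using vA closed by simp
    ultimately show ?thesis
      by (simp add: vec_chain_def A_def)
  qed
  then have "act_mod q gs w \<in> carrier stability_group"
    using auto by (simp add: stability_group_def stab_def)
  then show ?thesis
    unfolding A_def m_def .
qed

lemma act_mod_hom:
  assumes q: "q > 0" and gs: "distinct_adj gs"
  shows "act_mod q gs \<in> hom (free_group X)
    (group_chain.stability_group (vec_group (length gs) q) (vec_chain (length gs) q))"
proof -
  define m where "m = length gs"
  define A where "A = vec_group m q"
  interpret group_chain A "vec_chain m q" "Suc m"
    unfolding A_def using q by (rule group_chain_vec_chain)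
  have mem: "act_mod q gs w \<in> carrier stability_group" if "reduced w" for w
    using act_mod_stability_group[OF q gs that] unfolding A_def m_def .
  have "act_mod q gs (u \<otimes>\<^bsub>free_group X\<^esub> v) = act_mod q gs u \<otimes>\<^bsub>stability_group\<^esub> act_mod q gs v"
    if "u \<in> carrier (free_group X)" "v \<in> carrier (free_group X)" for u v
  proof -
    have "act_mod q gs u \<in> Bij (carrier A)" "act_mod q gs v \<in> Bij (carrier A)"
      using mem[of u] mem[of v] that auto_Bij[OF stab_auto]
      by (auto simp: carrier_free_group stability_group_def)
    then have "act_mod q gs u \<otimes>\<^bsub>stability_group\<^esub> act_mod q gs v
        = compose (carrier A) (act_mod q gs u) (act_mod q gs v)"
      by (simp add: stability_group_def BijGroup_def)
    also have "\<dots> = act_mod q gs (u \<otimes>\<^bsub>free_group X\<^esub> v)"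
      using q by (auto simp: compose_def act_mod_def A_def m_def red_vec_closed red_vec_act_red_vec
          mult_free_group act_mult[OF gs])
    finally show ?thesis
      by simp
  qed
  then have "act_mod q gs \<in> hom (free_group X) stability_group"
    using mem by (intro homI) (auto simp: carrier_free_group)
  then show ?thesis
    unfolding A_def m_def .
qed

section \<open>Separation\<close>

text \<open>One homomorphism serves all \<open>j\<close>: at the last coordinate moved by
  \<open>z\<close>, equal images would give \<open>k * \<alpha>\<close> congruent to
  \<open>m * j * \<alpha>\<close> modulo \<open>q\<close>.\<close>

lemma separate_powers:
  assumes z: "z \<in> carrier (free_group X)" and "z \<noteq> []" and ndvd: "\<not> m dvd (k :: int)"
  obtains H f where "H \<in> finite_nilpotent_groups" "f \<in> hom (free_group X) H"
    "\<And>j :: int. f (z [^]\<^bsub>free_group X\<^esub> k) \<noteq> f (z [^]\<^bsub>free_group X\<^esub> (m * j))"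
proof -
  define F where "F = free_group X"
  interpret F: group F
    unfolding F_def by (rule group_free_group)
  define gs where "gs = remdups_adj (map fst z)"
  define e where "e = last_unit gs"
  \<comment> \<open>Below the top coordinate \<open>e\<close> is zero, so \<open>I\<close> collects
    the coordinates of \<open>e\<close> that \<open>z\<close> moves.\<close>
  define I where "I = {j. j < length gs \<and> act gs z e j \<noteq> 0}"
  define i where "i = Max I"
  define \<alpha> where "\<alpha> = act gs z e i"
  have gs: "distinct_adj gs"
    by (simp add: gs_def)
  have fin: "finite I"
    by (simp add: I_def)
  have "0 \<in> I"
    using act_last_unit_nonzero[of z] assms by (simp add: I_def gs_def e_def carrier_free_group)
  then have "i \<in> I"
    unfolding i_def using fin by (intro Max_in) auto
  then have i: "i < length gs" and \<alpha>: "\<alpha> \<noteq> 0"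
    by (auto simp: I_def \<alpha>_def)
  have top: "act gs z e j = e j" if "i < j" "j \<le> length gs" for j
  proof (cases "j = length gs")
    case True
    then show ?thesis
      using act_upper[of j gs e "\<lambda>_. 0" j z] by (simp add: act_zero)
  next
    case False
    then have "j \<notin> I"
      using that Max_ge[OF fin, of j] by (auto simp: i_def)
    then show ?thesis
      using that False by (simp add: I_def e_def last_unit_def)
  qed
  have pow: "act gs (z [^]\<^bsub>F\<^esub> n) e i = n * \<alpha>" for n :: int
    using act_int_pow[OF gs z i, of n] top by (simp add: F_def e_def \<alpha>_def)
  \<comment> \<open>After cancelling \<alpha>, a collision means that \<open>M\<close> divides
    \<open>k - m * j\<close>. For \<open>m = 0\<close> the choice exceeds the absolute value of
    \<open>k\<close> and forces \<open>k = 0\<close>; otherwise it forces \<open>m\<close> to divide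
    \<open>k\<close>.\<close>
  define M where "M = (if m = 0 then \<bar>k\<bar> + 1 else \<bar>m\<bar>)"
  define q where "q = nat (\<bar>\<alpha>\<bar> * M)"
  have "M > 0"
    by (simp add: M_def)
  then have q: "q > 0" and q_eq: "int q = \<bar>\<alpha>\<bar> * M"
    using \<alpha> by (simp_all add: q_def)
  define A where "A = vec_group (length gs) q"
  interpret group_chain A "vec_chain (length gs) q" "Suc (length gs)"
    unfolding A_def using q by (rule group_chain_vec_chain)
  have "finite (carrier A)"
    unfolding A_def using q by (simp add: carrier_vec_group finite_PiE)
  then obtain H h where H: "H \<in> finite_nilpotent_groups" and h: "h \<in> iso stability_group H"
    using finite_nilpotent_nat_copy[OF finite_stability_group nilpotent_stability_group] by metis
  have hom: "act_mod q gs \<in> hom F stability_group"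
    using act_mod_hom[OF q gs, of X] unfolding A_def F_def .
  have "(h \<circ> act_mod q gs) (z [^]\<^bsub>F\<^esub> k) \<noteq> (h \<circ> act_mod q gs) (z [^]\<^bsub>F\<^esub> (m * j))" for j
  proof
    assume eq: "(h \<circ> act_mod q gs) (z [^]\<^bsub>F\<^esub> k) = (h \<circ> act_mod q gs) (z [^]\<^bsub>F\<^esub> (m * j))"
    have "inj_on h (carrier stability_group)"
      using h by (simp add: iso_def bij_betw_def)
    moreover have "act_mod q gs (z [^]\<^bsub>F\<^esub> n) \<in> carrier stability_group" for n :: int
      using hom z by (auto simp: hom_def F_def[symmetric])
    ultimately have "act_mod q gs (z [^]\<^bsub>F\<^esub> k) = act_mod q gs (z [^]\<^bsub>F\<^esub> (m * j))"
      using eq by (simp add: inj_on_eq_iff)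
    then have "act_mod q gs (z [^]\<^bsub>F\<^esub> k) (red_vec (length gs) q e) i
        = act_mod q gs (z [^]\<^bsub>F\<^esub> (m * j)) (red_vec (length gs) q e) i"
      by simp
    then have "(k * \<alpha>) mod int q = (m * j * \<alpha>) mod int q"
      using q i pow by (simp add: act_mod_red_vec) (simp add: red_vec_def)
    then have "int q dvd k * \<alpha> - m * j * \<alpha>"
      by (simp add: mod_eq_dvd_iff)
    then have "\<bar>\<alpha>\<bar> * M dvd \<alpha> * (k - m * j)"
      by (simp add: q_eq algebra_simps)
    then have "\<alpha> * M dvd \<alpha> * (k - m * j)"
      by (cases "\<alpha> \<ge> 0") auto
    then have M: "M dvd k - m * j"
      using \<alpha> by simp
    show False
    proof (cases "m = 0")
      case True
      then have "\<bar>k\<bar> + 1 dvd k"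
        using M by (simp add: M_def)
      then have "k = 0"
        using zdvd_not_zless[of "\<bar>k\<bar>" "\<bar>k\<bar> + 1"] by fastforce
      then show False
        using ndvd True by simp
    next
      case False
      then have "m dvd k - m * j"
        using M by (simp add: M_def)
      then show False
        using ndvd by (simp add: dvd_diff_left_iff)
    qed
  qed
  moreover have "h \<circ> act_mod q gs \<in> hom F H"
    using Group.hom_compose[OF hom, of h H] h by (simp add: iso_def)
  ultimately show ?thesis
    using H that unfolding F_def by blast
qed

text \<open>Closedness needs a single quotient that keeps \<open>u\<close> away from all powers of
  \<open>c\<close> at once, not one quotient for each power.\<close>

lemma separate_from_cyclic:
  assumes u: "u \<in> carrier (free_group X)" and c: "c \<in> carrier (free_group X)"
    and u_notin: "\<And>j :: int. u \<noteq> c [^]\<^bsub>free_group X\<^esub> j"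
  obtains H f where "H \<in> finite_nilpotent_groups" "f \<in> hom (free_group X) H"
    "\<And>j :: int. f u \<noteq> f (c [^]\<^bsub>free_group X\<^esub> j)"
proof -
  define F where "F = free_group X"
  interpret F: group F
    unfolding F_def by (rule group_free_group)
  have uF: "u \<in> carrier F" and cF: "c \<in> carrier F"
    using u c by (simp_all add: F_def)
  show ?thesis
  proof (cases "u \<otimes>\<^bsub>F\<^esub> c = c \<otimes>\<^bsub>F\<^esub> u")
    case True
    then obtain z k m where z: "z \<in> carrier F" and uz: "u = z [^]\<^bsub>F\<^esub> (k::int)" and cz: "c = z [^]\<^bsub>F\<^esub> (m::int)"
      using commuting_free_group[OF u c] by (auto simp: F_def)
    have cj: "c [^]\<^bsub>F\<^esub> j = z [^]\<^bsub>F\<^esub> (m * j)" for j :: int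
      using z by (simp add: cz F.int_pow_pow mult.commute)
    have "u \<noteq> \<one>\<^bsub>F\<^esub>"
      using u_notin[of 0] by (simp add: F_def)
    then have "z \<noteq> \<one>\<^bsub>F\<^esub>"
      using uz by auto
    then have "z \<noteq> []"
      by (simp add: F_def one_free_group)
    moreover have "\<not> m dvd k"
      using u_notin uz cj unfolding F_def[symmetric] by (metis dvdE)
    ultimately show ?thesis
      using separate_powers[of z X m k] that z cj uz unfolding F_def by metis
  next
    case False
    define z where "z = u \<otimes>\<^bsub>F\<^esub> c \<otimes>\<^bsub>F\<^esub> inv\<^bsub>F\<^esub> (c \<otimes>\<^bsub>F\<^esub> u)"
    have z: "z \<in> carrier F"
      using uF cF by (simp add: z_def)
    have "z \<noteq> \<one>\<^bsub>F\<^esub>"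
      using False uF cF unfolding z_def by (metis F.inv_closed F.inv_equality F.inv_inv F.m_closed)
    then have "z \<noteq> []"
      by (simp add: F_def one_free_group)
    \<comment> \<open>With \<open>m = 0\<close> and \<open>k = 1\<close>,
      \<open>separate_powers\<close> says that the commutator \<open>z\<close> has nontrivial
      image.\<close>
    moreover have "\<not> 0 dvd (1::int)"
      by simp
    ultimately obtain H f where H: "H \<in> finite_nilpotent_groups" and f: "f \<in> hom F H"
      and fz: "\<And>j :: int. f (z [^]\<^bsub>F\<^esub> (1::int)) \<noteq> f (z [^]\<^bsub>F\<^esub> (0 * j))"
      using separate_powers[of z X 0 1] z unfolding F_def by metis
    interpret f: group_hom F H f
      using f H F.is_group
      by (simp add: group_hom_def group_hom_axioms_def finite_nilpotent_groups_def nilpotent_group_def)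
    have "f z \<noteq> \<one>\<^bsub>H\<^esub>"
      using fz[of 0] z by simp
    have "f u \<noteq> f (c [^]\<^bsub>F\<^esub> j)" for j :: int
    proof
      assume eq: "f u = f (c [^]\<^bsub>F\<^esub> j)"
      \<comment> \<open>If \<open>f u\<close> were the image of a power of \<open>c\<close>, it
        would commute with \<open>f c\<close>, and the commutator \<open>z\<close> would die in
        \<open>H\<close>.\<close>
      have "c [^]\<^bsub>F\<^esub> j \<otimes>\<^bsub>F\<^esub> c = c \<otimes>\<^bsub>F\<^esub> c [^]\<^bsub>F\<^esub> j"
        using F.int_pow_mult[OF cF, of j 1] F.int_pow_mult[OF cF, of 1 j] cF
        by (simp add: add.commute)
      then have "f (c [^]\<^bsub>F\<^esub> j \<otimes>\<^bsub>F\<^esub> c) = f (c \<otimes>\<^bsub>F\<^esub> c [^]\<^bsub>F\<^esub> j)"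
        by simp
      then have "f (u \<otimes>\<^bsub>F\<^esub> c) = f (c \<otimes>\<^bsub>F\<^esub> u)"
        using uF cF by (simp add: eq)
      then have "f z = \<one>\<^bsub>H\<^esub>"
        using uF cF by (simp only: z_def f.hom_mult F.m_closed F.inv_closed f.hom_inv) simp
      then show False
        using \<open>f z \<noteq> \<one>\<^bsub>H\<^esub>\<close> by simp
    qed
    then show ?thesis
      using that H f unfolding F_def by blast
  qed
qed

section \<open>From separation to closedness\<close>

theorem theorem4p1:
  fixes G :: "('a, 'm) monoid_scheme" and X :: "'b set" and C :: "'a set"
  assumes "group G" and "G \<cong> free_group X"
    and "subgroup C G" and "cyclic_group (G\<lparr>carrier := C\<rparr>)"
  shows "closedin (pro_topology finite_nilpotent_groups G) C"
proof -
  interpret G: group G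
    by fact
  interpret C: group "G\<lparr>carrier := C\<rparr>"
    using G.subgroup_imp_group[OF assms(3)] .
  obtain g where g: "g \<in> C" and "C = range (\<lambda>n::int. g [^]\<^bsub>G\<lparr>carrier := C\<rparr>\<^esub> n)"
    using assms(4) C.cyclic_group by auto
  then have C_eq: "C = range (\<lambda>n::int. g [^]\<^bsub>G\<^esub> n)"
    using G.int_pow_consistent[OF assms(3) g] by simp
  have gG: "g \<in> carrier G"
    using g subgroup.subset[OF assms(3)] by blast
  obtain h where h: "h \<in> iso G (free_group X)"
    using assms(2) by (auto simp: is_iso_def)
  interpret h: group_hom G "free_group X" h
    using h group_free_group by (auto simp: group_hom_def group_hom_axioms_def iso_def G.is_group)
  have inj: "inj_on h (carrier G)"
    using h by (simp add: iso_def bij_betw_def)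
  have h_pow: "h (g [^]\<^bsub>G\<^esub> n) = h g [^]\<^bsub>free_group X\<^esub> n" for n :: int
    using gG by (rule h.hom_int_pow)
  let ?T = "pro_topology finite_nilpotent_groups G"
  have open_nhd: "\<exists>U. openin ?T U \<and> x \<in> U \<and> U \<subseteq> carrier G - C" if x: "x \<in> carrier G - C" for x
  proof -
    have "h x \<noteq> h g [^]\<^bsub>free_group X\<^esub> j" for j :: int
      using x gG C_eq inj_onD[OF inj, of x "g [^]\<^bsub>G\<^esub> j"] by (auto simp: h_pow)
    then obtain H f where H: "H \<in> finite_nilpotent_groups" and f: "f \<in> hom (free_group X) H"
      and sep: "\<And>j :: int. f (h x) \<noteq> f (h g [^]\<^bsub>free_group X\<^esub> j)"
      using separate_from_cyclic[of "h x" X "h g"] x gG by (metis Diff_iff h.hom_closed)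
    have fh: "f \<circ> h \<in> hom G H"
      using h.homh f by (rule Group.hom_compose)
    \<comment> \<open>The preimage of the complement of the image of \<open>C\<close> is a
      generating open set that misses \<open>C\<close>; the separation for all \<open>j\<close> puts
      \<open>x\<close> into it.\<close>
    let ?S = "carrier H - (f \<circ> h) ` C"
    let ?U = "{y \<in> carrier G. (f \<circ> h) y \<in> ?S}"
    have "openin ?T ?U"
      unfolding pro_topology_def
      by (rule topology_generated_by_Basis) (use H fh in blast)
    moreover have "x \<in> ?U"
    proof -
      have "f (h x) \<noteq> f (h y)" if y: "y \<in> C" for y
      proof -
        obtain j :: int where "y = g [^]\<^bsub>G\<^esub> j"
          using y unfolding C_eq by blast
        then show ?thesis
          using sep[of j] by (simp add: h_pow)
      qed
      then have "(f \<circ> h) x \<notin> (f \<circ> h) ` C"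
        by (simp add: image_iff)
      then show ?thesis
        using x hom_in_carrier[OF fh, of x] by simp
    qed
    ultimately show ?thesis
      by blast
  qed
  \<comment> \<open>The trivial group witnesses that the pseudovariety is nonempty, which makes the
    underlying set of the topology all of \<open>carrier G\<close>.\<close>
  define K :: "nat monoid" where "K = \<lparr>carrier = {0}, monoid.mult = (\<lambda>_ _. 0), one = 0\<rparr>"
  have "group K"
    by (rule groupI) (simp_all add: K_def)
  moreover have "lower_central K 0 = {\<one>\<^bsub>K\<^esub>}"
    by (simp add: K_def)
  moreover have "finite (carrier K)"
    by (simp add: K_def)
  ultimately have "K \<in> finite_nilpotent_groups"
    unfolding finite_nilpotent_groups_def nilpotent_group_def by blast
  then have top: "topspace ?T = carrier G"
    using \<open>group K\<close> by (rule topspace_pro_topology)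
  have "openin ?T (carrier G - C)"
    using open_nhd by (subst openin_subopen) blast
  then show ?thesis
    using top subgroup.subset[OF assms(3)] by (simp add: closedin_def)
qed

end
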